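(* Let $A \subseteq \mathbb{R}$ and $B = \mathbb{R} \setminus A$. Then the following conditions are equivalent. (a) There exist a $\sigma$-compact subset $D$ and a closed subset $C$ of the space $H(A)$ such that $B \subseteq C \subseteq D$. (b) There exists a closed $\sigma$-compact subset $C$ of the space $H(A)$ such that $B \subseteq C$. (c) The closure $\mathrm{Cl}_{H(\mathbb{R})}(B)$ of $B$ in the real line (Euclidean topology) is $\sigma$-compact as a subset of $H(A)$. (d) The closure $\mathrm{Cl}_{H(A)}(B)$ of $B$ in the space $H(A)$ is $\sigma$-compact as a subset of $H(A)$. (e) The space $H(A)$ is $\sigma$-compact.
   Context: For $A \subseteq \mathbb{R}$, the Hattori space $H(A)$ is the set $\mathbb{R}$ with the topology $\tau(A)$ in which a point $x \in A$ has open neighbourhood basis $\{(x-\epsilon, x+\epsilon) : \epsilon > 0\}$ and a point $x \in \mathbb{R}\setminus A$ has open neighbourhood basis $\{[x, x+\epsilon) : \epsilon > 0\}$. Thus $H(\mathbb{R})$ is the real line with the Euclidean topology and $H(\emptyset)$ is the Sorgenfrey line. A space (or subset of a space) is $\sigma$-compact if it is a union of countably many compact subsets. $\mathrm{Cl}_X(B)$ denotes the closure of $B$ in the space $X$. *)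

theory Defs
  imports "HOL-Analysis.Analysis"
begin

definition hattori :: "real set \<Rightarrow> real topology" where
  "hattori A = topology (\<lambda>U.
     (\<forall>x \<in> U \<inter> A. \<exists>e>0. {x - e<..<x + e} \<subseteq> U) \<and>
     (\<forall>x \<in> U - A. \<exists>e>0. {x..<x + e} \<subseteq> U))"

lemma istopology_hattori:
  "istopology (\<lambda>U.
     (\<forall>x \<in> U \<inter> A. \<exists>e>0. {x - e<..<x + e} \<subseteq> U) \<and>
     (\<forall>x \<in> U - A. \<exists>e>0. {x..<x + e} \<subseteq> (U :: real set)))"
proof -
  have two_sided: "\<exists>e>0. {x - e<..<x + e} \<subseteq> S \<inter> T"
    if "\<exists>e>0. {x - e<..<x + e} \<subseteq> S" "\<exists>e>0. {x - e<..<x + e} \<subseteq> T"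
    for x :: real and S T
  proof -
    from that obtain d e where de: "d > 0" "{x - d<..<x + d} \<subseteq> S" "e > 0" "{x - e<..<x + e} \<subseteq> T"
      by blast
    have "{x - min d e<..<x + min d e} \<subseteq> {x - d<..<x + d} \<inter> {x - e<..<x + e}"
      by auto
    with de have "min d e > 0 \<and> {x - min d e<..<x + min d e} \<subseteq> S \<inter> T"
      by (metis Int_mono min_less_iff_conj order_trans)
    then show ?thesis by blast
  qed
  have right: "\<exists>e>0. {x..<x + e} \<subseteq> S \<inter> T"
    if "\<exists>e>0. {x..<x + e} \<subseteq> S" "\<exists>e>0. {x..<x + e} \<subseteq> T"
    for x :: real and S T
  proof -
    from that obtain d e where de: "d > 0" "{x..<x + d} \<subseteq> S" "e > 0" "{x..<x + e} \<subseteq> T"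
      by blast
    have "{x..<x + min d e} \<subseteq> {x..<x + d} \<inter> {x..<x + e}"
      by auto
    with de have "min d e > 0 \<and> {x..<x + min d e} \<subseteq> S \<inter> T"
      by (metis Int_mono min_less_iff_conj order_trans)
    then show ?thesis by blast
  qed
  show ?thesis
    unfolding istopology_def
  proof (intro conjI allI impI ballI, goal_cases)
    case (1 S T x) then show ?case by (intro two_sided) auto
  next
    case (2 S T x) then show ?case by (intro right) auto
  next
    case (3 K x)
    then obtain S where "S \<in> K" "x \<in> S \<inter> A" by auto
    with 3 show ?case by (meson Union_upper order_trans)
  next
    case (4 K x)
    then obtain S where "S \<in> K" "x \<in> S - A" by auto
    with 4 show ?case by (meson Union_upper order_trans)
  qed
qed

lemma openin_hattori:
  "openin (hattori A) U \<longleftrightarrow>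
     (\<forall>x \<in> U \<inter> A. \<exists>e>0. {x - e<..<x + e} \<subseteq> U) \<and>
     (\<forall>x \<in> U - A. \<exists>e>0. {x..<x + e} \<subseteq> U)"
  unfolding hattori_def using istopology_hattori[of A] by (simp add: topology_inverse')

lemma topspace_hattori [simp]: "topspace (hattori A) = UNIV"
proof -
  have "openin (hattori A) UNIV"
    by (auto simp: openin_hattori intro: exI[of _ 1])
  then show ?thesis
    using openin_subset by blast
qed

lemma openin_hattori_greaterThanLessThan: "openin (hattori A) {a<..<b}"
proof -
  have "\<exists>e>0. {x - e<..<x + e} \<subseteq> {a<..<b}" if "x \<in> {a<..<b}" for x
    using that by (intro exI[of _ "min (x - a) (b - x)"]) auto
  moreover have "\<exists>e>0. {x..<x + e} \<subseteq> {a<..<b}" if "x \<in> {a<..<b}" for x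
    using that by (intro exI[of _ "b - x"]) auto
  ultimately show ?thesis by (simp add: openin_hattori)
qed

lemma openin_hattori_atLeastLessThan:
  assumes "a \<notin> A"
  shows "openin (hattori A) {a..<b}"
proof -
  have "\<exists>e>0. {x - e<..<x + e} \<subseteq> {a..<b}" if "x \<in> {a..<b} \<inter> A" for x
  proof -
    have "a \<noteq> x" using that assms by auto
    then show ?thesis
      using that by (intro exI[of _ "min (x - a) (b - x)"]) auto
  qed
  moreover have "\<exists>e>0. {x..<x + e} \<subseteq> {a..<b}" if "x \<in> {a..<b} - A" for x
    using that by (intro exI[of _ "b - x"]) auto
  ultimately show ?thesis by (simp add: openin_hattori)
qed

lemma hattori_UNIV: "hattori UNIV = euclidean"
proof -
  have "{x - e<..<x + e} = ball x e" for x e :: real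
    by (auto simp: ball_def dist_real_def)
  then have "openin (hattori UNIV) U \<longleftrightarrow> openin euclidean U" for U
    by (auto simp: openin_hattori open_contains_ball)
  then show ?thesis by (simp add: topology_eq)
qed

definition sigma_compactin :: "'a topology \<Rightarrow> 'a set \<Rightarrow> bool" where
  "sigma_compactin X S \<longleftrightarrow>
     (\<exists>\<K>. countable \<K> \<and> (\<forall>K \<in> \<K>. compactin X K) \<and> S = \<Union>\<K>)"

end

theory Submission
  imports Defs
begin

text \<open>
  A closed set \<open>C \<supseteq> B\<close> has its complement inside \<open>A\<close>, where the Hattori topology and the Euclidean one
  have the same neighbourhoods. Hence the complement is Euclidean open, a countable union of
  compact intervals, and these stay compact in the Hattori space because they lie in \<open>A\<close>. So
  the whole space is \<open>\<sigma>\<close>-compact as soon as \<open>C\<close> is; conversely \<open>\<sigma>\<close>-compactness passes to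
  closed subsets.
\<close>

lemma sigma_compactin_Un:
  assumes "sigma_compactin X S" "sigma_compactin X T"
  shows "sigma_compactin X (S \<union> T)"
proof -
  obtain K L where "countable K" "\<forall>k\<in>K. compactin X k" "S = \<Union>K"
    and "countable L" "\<forall>k\<in>L. compactin X k" "T = \<Union>L"
    using assms unfolding sigma_compactin_def by blast
  then show ?thesis
    unfolding sigma_compactin_def by (intro exI[of _ "K \<union> L"]) auto
qed

text \<open>Each compact piece of \<open>D\<close> stays compact when cut down to the closed set
  \<open>C\<close>, and the countably many cut pieces still cover \<open>C\<close>.\<close>

lemma sigma_compactin_closedin_subset:
  assumes "sigma_compactin X D" "closedin X C" "C \<subseteq> D"
  shows "sigma_compactin X C"
proof -
  obtain K where K: "countable K" "\<forall>k\<in>K. compactin X k" "D = \<Union>K"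
    using assms unfolding sigma_compactin_def by blast
  have "compactin X (C \<inter> k)" if "k \<in> K" for k
    using closed_Int_compactin assms(2) K(2) that by blast
  moreover have "C = \<Union>((\<inter>) C ` K)"
    using K(3) assms(3) by auto
  ultimately show ?thesis
    unfolding sigma_compactin_def using K(1) by (intro exI[of _ "(\<inter>) C ` K"]) auto
qed

text \<open>The Hattori topology refines the Euclidean one, since a two-sided interval about
  \<open>x\<close> contains the right half-open interval starting at \<open>x\<close>.\<close>

lemma openin_hattori_if_open:
  assumes "open U"
  shows "openin (hattori A) U"
proof -
  have "openin (hattori UNIV) U"
    using assms by (simp add: hattori_UNIV)
  then have e: "\<exists>e>0. {x - e<..<x + e} \<subseteq> U" if "x \<in> U" for x
    using that by (simp add: openin_hattori)
  moreover have "\<exists>e>0. {x..<x + e} \<subseteq> U" if x: "x \<in> U" for x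
  proof -
    obtain e where "e > 0" "{x - e<..<x + e} \<subseteq> U"
      using e[OF x] by blast
    moreover have "{x..<x + e} \<subseteq> {x - e<..<x + e}"
      using \<open>e > 0\<close> by auto
    ultimately show ?thesis by blast
  qed
  ultimately show ?thesis by (simp add: openin_hattori)
qed

lemma closedin_hattori_if_closed: "closed S \<Longrightarrow> closedin (hattori A) S"
  by (simp add: closedin_def openin_hattori_if_open open_Diff)

lemma hattori_Int_subset_interior:
  assumes "openin (hattori A) U"
  shows "U \<inter> A \<subseteq> interior U"
proof
  fix x assume "x \<in> U \<inter> A"
  then obtain e where "e > 0" "{x - e<..<x + e} \<subseteq> U"
    using assms unfolding openin_hattori by blast
  then show "x \<in> interior U"
    by (intro interiorI[of "{x - e<..<x + e}"]) auto
qed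

text \<open>Replace each member of a Hattori-open cover by its Euclidean interior. No point of
  \<open>K\<close> is lost because \<open>K\<close> lies in \<open>A\<close>, so Euclidean
  compactness yields a finite subcover, and the original members contain their interiors.\<close>

lemma compactin_hattori_if_compact:
  assumes "compact K" "K \<subseteq> A"
  shows "compactin (hattori A) K"
  unfolding compactin_def
proof (intro conjI allI impI)
  fix \<U> assume \<U>: "Ball \<U> (openin (hattori A)) \<and> K \<subseteq> \<Union>\<U>"
  have "K \<subseteq> \<Union>(interior ` \<U>)"
    using \<U> assms(2) hattori_Int_subset_interior by blast
  then obtain \<V> where "\<V> \<subseteq> \<U>" "finite \<V>" "K \<subseteq> \<Union>(interior ` \<V>)"
    using compactE_image[OF assms(1), of \<U> interior] open_interior by metis
  moreover have "(\<Union>X\<in>\<V>. interior X) \<subseteq> (\<Union>X\<in>\<V>. X)"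
    by (intro UN_mono subset_refl interior_subset)
  ultimately show "\<exists>\<F>. finite \<F> \<and> \<F> \<subseteq> \<U> \<and> K \<subseteq> \<Union>\<F>"
    by (intro exI[of _ \<V>]) auto
qed simp

lemma sigma_compactin_hattori_openin:
  assumes "openin (hattori A) U" "U \<subseteq> A"
  shows "sigma_compactin (hattori A) U"
proof -
  \<comment> \<open>From \<open>U \<subseteq> A\<close> the set \<open>U \<inter> A\<close> is all
    of \<open>U\<close>, so \<open>U\<close> equals its Euclidean interior.\<close>
  have "open U"
    using hattori_Int_subset_interior[OF assms(1)] assms(2)
    by (metis inf.absorb1 interior_eq interior_subset subset_antisym)
  then obtain \<D> where \<D>: "countable \<D>" "\<D> \<subseteq> Pow U"
      "\<And>X. X \<in> \<D> \<Longrightarrow> \<exists>a b. X = cbox a b" "\<Union>\<D> = U"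
    using open_countable_Union_open_cbox by metis
  have "compactin (hattori A) X" if "X \<in> \<D>" for X
  proof (rule compactin_hattori_if_compact)
    show "compact X" using \<D>(3)[OF that] compact_cbox by auto
    show "X \<subseteq> A" using \<D>(2) assms(2) that by blast
  qed
  with \<D> show ?thesis unfolding sigma_compactin_def by blast
qed

lemma sigma_compactin_hattori_UNIV:
  assumes "closedin (hattori A) C" "sigma_compactin (hattori A) C" "- A \<subseteq> C"
  shows "sigma_compactin (hattori A) UNIV"
proof -
  have "openin (hattori A) (- C)"
    using assms(1) unfolding closedin_def by (metis Compl_eq_Diff_UNIV topspace_hattori)
  then have "sigma_compactin (hattori A) (- C)"
    by (rule sigma_compactin_hattori_openin) (use assms(3) in auto)
  then have "sigma_compactin (hattori A) (C \<union> - C)"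
    using assms(2) by (rule sigma_compactin_Un[rotated])
  then show ?thesis by simp
qed

theorem theorem2p1:
  fixes A B :: "real set"
  assumes B: "B = UNIV - A"
  shows
    "((\<exists>D C. sigma_compactin (hattori A) D \<and> closedin (hattori A) C \<and> B \<subseteq> C \<and> C \<subseteq> D)
       \<longleftrightarrow> (\<exists>C. closedin (hattori A) C \<and> sigma_compactin (hattori A) C \<and> B \<subseteq> C))
   \<and> ((\<exists>C. closedin (hattori A) C \<and> sigma_compactin (hattori A) C \<and> B \<subseteq> C)
       \<longleftrightarrow> sigma_compactin (hattori A) (hattori UNIV closure_of B))
   \<and> (sigma_compactin (hattori A) (hattori UNIV closure_of B)
       \<longleftrightarrow> sigma_compactin (hattori A) (hattori A closure_of B))
   \<and> (sigma_compactin (hattori A) (hattori A closure_of B)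
       \<longleftrightarrow> sigma_compactin (hattori A) (topspace (hattori A)))"
proof -
  let ?H = "hattori A"
  let ?E = "hattori UNIV closure_of B" and ?S = "?H closure_of B"
  have BA: "B = - A"
    using B by auto
  \<comment> \<open>A Euclidean closure is also closed in the finer topology
    \<open>?H\<close>.\<close>
  have E: "closedin ?H ?E" "B \<subseteq> ?E"
    by (auto simp: hattori_UNIV closedin_hattori_if_closed closure_subset)
  have S: "closedin ?H ?S" "B \<subseteq> ?S"
    by (auto simp: closure_of_subset)
  have whole: "sigma_compactin ?H UNIV"
    if "closedin ?H C" "sigma_compactin ?H C" "B \<subseteq> C" for C
    using sigma_compactin_hattori_UNIV that BA by blast
  have closed: "sigma_compactin ?H C" if "sigma_compactin ?H D" "closedin ?H C" "C \<subseteq> D" for C D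
    using sigma_compactin_closedin_subset that by blast
  \<comment> \<open>Every condition is compared with (e) alone, which gives all the equivalences.
    Here (e) implies (a) by taking \<open>C\<close> and \<open>D\<close> to be the whole
    line.\<close>
  have a: "(\<exists>D C. sigma_compactin ?H D \<and> closedin ?H C \<and> B \<subseteq> C \<and> C \<subseteq> D)
      \<longleftrightarrow> sigma_compactin ?H UNIV"
    using whole closed closedin_topspace[of ?H] unfolding topspace_hattori by blast
  have b: "(\<exists>C. closedin ?H C \<and> sigma_compactin ?H C \<and> B \<subseteq> C) \<longleftrightarrow> sigma_compactin ?H UNIV"
    using whole closedin_topspace[of ?H] unfolding topspace_hattori by blast
  \<comment> \<open>The closure itself serves as the closed set containing \<open>B\<close>;
    conversely it is a closed subset of the whole space.\<close>
  have c: "sigma_compactin ?H ?E \<longleftrightarrow> sigma_compactin ?H UNIV"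
    using whole[OF E(1) _ E(2)] closed[OF _ E(1)] by blast
  have d: "sigma_compactin ?H ?S \<longleftrightarrow> sigma_compactin ?H UNIV"
    using whole[OF S(1) _ S(2)] closed[OF _ S(1)] by blast
  show ?thesis
    unfolding a b c d topspace_hattori by blast
qed

end
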